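(* Let $a\ge 0$ and $0<\alpha<1$. Also, let $f$ be a continuous function such that the $M$-integral ${}_M\mathcal{I}_a^{\alpha,\beta}f$ exists. Then $$\mathscr{D}_M^{\alpha,\beta}\big({}_M\mathcal{I}_a^{\alpha,\beta}f(t)\big)=f(t),$$ with $t\ge a$ and $\beta>0$.
   Context: For $\beta>0$, $\mathbb{E}_\beta(x)=\sum_{k=0}^\infty \frac{x^k}{\Gamma(\beta k+1)}$ is the one-parameter Mittag-Leffler function. For $0<\alpha<1$, $\beta>0$ and $t>0$, the local $M$-derivative of order $\alpha$ of a real-valued function $h$ at $t$ is $$\mathscr{D}_M^{\alpha,\beta}h(t)=\lim_{\varepsilon\to 0}\frac{h\big(t\,\mathbb{E}_\beta(\varepsilon t^{-\alpha})\big)-h(t)}{\varepsilon},$$ and, if $h$ is $\alpha$-differentiable (this limit exists) on some interval $(0,r)$, $r>0$, and $\lim_{t\to0^+}\mathscr{D}_M^{\alpha,\beta}h(t)$ exists, then $\mathscr{D}_M^{\alpha,\beta}h(0)=\lim_{t\to0^+}\mathscr{D}_M^{\alpha,\beta}h(t)$. For $a\ge0$, $t\ge a$, $0<\alpha<1$, $\beta>0$ and a function $f$ defined in $(a,t]$, the $M$-integral of order $\alpha$ of $f$ is $${}_M\mathcal{I}_a^{\alpha,\beta}f(t)=\Gamma(\beta+1)\int_a^t\frac{f(x)}{x^{1-\alpha}}\,dx .$$ *)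

theory Defs
  imports "HOL-Analysis.Analysis"
begin

definition mittag_leffler :: "real \<Rightarrow> real \<Rightarrow> real" where
  "mittag_leffler \<beta> x = (\<Sum>k. x ^ k / Gamma (\<beta> * real k + 1))"

text \<open>
  \<open>S\<close> is the domain of \<open>h\<close>, and \<open>\<epsilon>\<close> ranges over those values for which the perturbed argument
  stays in \<open>S\<close>. At interior points of \<open>S\<close> this is the ordinary two-sided limit; at an endpoint
  of an interval it is one-sided. The non-triviality condition rules out limits that hold vacuously.
\<close>

definition has_M_derivative_pos ::
    "real \<Rightarrow> real \<Rightarrow> real set \<Rightarrow> (real \<Rightarrow> real) \<Rightarrow> real \<Rightarrow> real \<Rightarrow> bool" where
  "has_M_derivative_pos \<alpha> \<beta> S h t L \<longleftrightarrow>
     (let F = at 0 within {\<epsilon>. t * mittag_leffler \<beta> (\<epsilon> * t powr (-\<alpha>)) \<in> S}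
      in t > 0 \<and> t \<in> S \<and> F \<noteq> bot \<and>
         ((\<lambda>\<epsilon>. (h (t * mittag_leffler \<beta> (\<epsilon> * t powr (-\<alpha>))) - h t) / \<epsilon>) \<longlongrightarrow> L) F)"

definition has_M_derivative_zero ::
    "real \<Rightarrow> real \<Rightarrow> real set \<Rightarrow> (real \<Rightarrow> real) \<Rightarrow> real \<Rightarrow> bool" where
  "has_M_derivative_zero \<alpha> \<beta> S h L \<longleftrightarrow>
     (\<exists>r>0. \<exists>g. (\<forall>s\<in>{0<..<r}. has_M_derivative_pos \<alpha> \<beta> S h s (g s)) \<and>
               (g \<longlongrightarrow> L) (at_right 0))"

definition has_M_derivative ::
    "real \<Rightarrow> real \<Rightarrow> real set \<Rightarrow> (real \<Rightarrow> real) \<Rightarrow> real \<Rightarrow> real \<Rightarrow> bool" where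
  "has_M_derivative \<alpha> \<beta> S h t L \<longleftrightarrow>
     (if t = 0 then has_M_derivative_zero \<alpha> \<beta> S h L else has_M_derivative_pos \<alpha> \<beta> S h t L)"

lemma has_M_derivative_pos_unique:
  assumes "has_M_derivative_pos \<alpha> \<beta> S h t L" "has_M_derivative_pos \<alpha> \<beta> S h t L'"
  shows "L = L'"
  using assms unfolding has_M_derivative_pos_def Let_def by (blast intro: tendsto_unique)

lemma has_M_derivative_unique:
  assumes "has_M_derivative \<alpha> \<beta> S h t L" "has_M_derivative \<alpha> \<beta> S h t L'"
  shows "L = L'"
proof (cases "t = 0")
  case True
  obtain r g where r: "r > 0" "\<forall>s\<in>{0<..<r}. has_M_derivative_pos \<alpha> \<beta> S h s (g s)"
    and g: "(g \<longlongrightarrow> L) (at_right 0)"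
    using assms(1) True unfolding has_M_derivative_def has_M_derivative_zero_def by auto
  obtain r' g' where r': "r' > 0" "\<forall>s\<in>{0<..<r'}. has_M_derivative_pos \<alpha> \<beta> S h s (g' s)"
    and g': "(g' \<longlongrightarrow> L') (at_right 0)"
    using assms(2) True unfolding has_M_derivative_def has_M_derivative_zero_def by auto
  have "\<forall>\<^sub>F s in at_right 0. s \<in> {0<..<min r r'}"
    using r r' by (intro eventually_at_right_real) auto
  then have "\<forall>\<^sub>F s in at_right 0. g s = g' s"
    by eventually_elim
      (metis r(2) r'(2) has_M_derivative_pos_unique greaterThanLessThan_iff min_less_iff_conj)
  then have "(g' \<longlongrightarrow> L) (at_right 0)"
    using g tendsto_cong by blast
  then show ?thesis
    using g' tendsto_unique trivial_limit_at_right_real by blast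
qed (use assms has_M_derivative_pos_unique in \<open>auto simp: has_M_derivative_def\<close>)

text \<open>
  The Henstock-Kurzweil integral is not affected by the value of the integrand at \<open>a\<close>, and it
  includes the improper integrals that arise from a singularity there.
\<close>

definition M_integrable :: "real \<Rightarrow> real \<Rightarrow> (real \<Rightarrow> real) \<Rightarrow> real \<Rightarrow> bool" where
  "M_integrable \<alpha> a f t \<longleftrightarrow> (\<lambda>x. f x / x powr (1 - \<alpha>)) integrable_on {a..t}"

definition M_integral :: "real \<Rightarrow> real \<Rightarrow> real \<Rightarrow> (real \<Rightarrow> real) \<Rightarrow> real \<Rightarrow> real" where
  "M_integral \<alpha> \<beta> a f t = Gamma (\<beta> + 1) * integral {a..t} (\<lambda>x. f x / x powr (1 - \<alpha>))"

end

theory Submission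
  imports Defs
begin

text \<open>
  The power series of the Mittag-Leffler function gives value \<open>1\<close> and derivative
  \<open>1 / Gamma (\<beta> + 1)\<close> at \<open>0\<close>. Hence \<open>\<epsilon> \<mapsto> t * mittag_leffler \<beta> (\<epsilon> * t powr (-\<alpha>))\<close> passes through \<open>t\<close>
  at \<open>\<epsilon> = 0\<close> with speed \<open>t powr (1 - \<alpha>) / Gamma (\<beta> + 1) > 0\<close>. By the chain rule the
  \<open>M\<close>-derivative at \<open>t > 0\<close> is the ordinary derivative times this speed, and for the \<open>M\<close>-integral
  the speed cancels against the weight \<open>Gamma (\<beta> + 1) / t powr (1 - \<alpha>)\<close> supplied by the
  fundamental theorem of calculus. The case \<open>t = 0\<close> follows by continuity of \<open>f\<close>.
\<close>

text \<open>Compactness gives a positive minimum on \<open>{1..2}\<close>, and the recurrence for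
  \<open>Gamma\<close> carries it to the right, one unit per induction step, since the factor
  \<open>x - 1\<close> exceeds 1 when \<open>x > 2\<close>.\<close>

lemma Gamma_real_bounded_below:
  obtains c :: real where "c > 0" "\<And>x. x \<ge> 1 \<Longrightarrow> Gamma x \<ge> c"
proof -
  have "continuous_on {1..2::real} Gamma"
    by (intro continuous_on_Gamma continuous_on_id) (auto elim!: nonpos_Ints_cases)
  then obtain y where y: "y \<in> {1..2::real}" "\<And>x. x \<in> {1..2} \<Longrightarrow> Gamma y \<le> Gamma x"
    using continuous_attains_inf[of "{1..2::real}" Gamma] by auto
  have step: "Gamma y \<le> Gamma x" if "x \<ge> 1" "x \<le> real n + 2" for n x
    using that
  proof (induction n arbitrary: x)
    case 0
    then show ?case using y(2) by simp
  next
    case (Suc n)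
    show ?case
    proof (cases "x \<le> 2")
      case True
      then show ?thesis using Suc y(2) by simp
    next
      case False
      then have "x - 1 \<notin> \<int>\<^sub>\<le>\<^sub>0"
        using nonpos_Ints_nonpos[of "x - 1"] by auto
      have "Gamma y \<le> Gamma (x - 1)"
        using Suc False by auto
      also have "\<dots> \<le> (x - 1) * Gamma (x - 1)"
        using False Gamma_real_pos[of "x - 1"] by simp
      also have "\<dots> = Gamma x"
        using Gamma_plus1[OF \<open>x - 1 \<notin> \<int>\<^sub>\<le>\<^sub>0\<close>] by simp
      finally show ?thesis .
    qed
  qed
  show ?thesis
  proof
    show "Gamma y > 0"
      using y(1) by (intro Gamma_real_pos) auto
    show "Gamma y \<le> Gamma x" if "x \<ge> 1" for x
    proof (rule step[OF that])
      show "x \<le> real (nat \<lceil>x\<rceil>) + 2"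
        using that by linarith
    qed
  qed
qed

lemma mittag_leffler_0 [simp]: "mittag_leffler \<beta> 0 = 1"
  unfolding mittag_leffler_def
  using powser_zero[of "\<lambda>k. 1 / Gamma (\<beta> * real k + 1)"] by simp

text \<open>The lower bound on \<open>Gamma\<close> gives a geometric majorant. The unit disc
  suffices, as only the behaviour at 0 matters below.\<close>

lemma summable_mittag_leffler:
  assumes "\<beta> > 0" "\<bar>x\<bar> < 1"
  shows "summable (\<lambda>k. 1 / Gamma (\<beta> * real k + 1) * x ^ k)"
proof -
  obtain c :: real where c: "c > 0" "\<And>x. x \<ge> 1 \<Longrightarrow> Gamma x \<ge> c"
    using Gamma_real_bounded_below by blast
  show ?thesis
  proof (rule summable_comparison_test')
    show "summable (\<lambda>k. 1 / c * \<bar>x\<bar> ^ k)"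
      using assms by (intro summable_mult summable_geometric) auto
    fix k :: nat
    have "Gamma (\<beta> * real k + 1) \<ge> c"
      using assms by (intro c(2)) auto
    then show "norm (1 / Gamma (\<beta> * real k + 1) * x ^ k) \<le> 1 / c * \<bar>x\<bar> ^ k"
      using c(1) by (auto simp: abs_mult power_abs intro!: mult_right_mono frac_le)
  qed
qed

lemma has_field_derivative_mittag_leffler_0:
  assumes "\<beta> > 0"
  shows "(mittag_leffler \<beta> has_field_derivative 1 / Gamma (\<beta> + 1)) (at 0)"
proof -
  let ?c = "\<lambda>k. 1 / Gamma (\<beta> * real k + 1)"
  have "((\<lambda>x. \<Sum>k. ?c k * x ^ k) has_field_derivative (\<Sum>k. diffs ?c k * 0 ^ k)) (at 0)"
    \<comment> \<open>Any nonzero point of the unit disc would serve in place of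
      \<open>1/2\<close>.\<close>
    by (rule termdiffs_strong[of _ "1/2"]) (use summable_mittag_leffler[OF assms, of "1/2"] in auto)
  moreover have "(\<Sum>k. diffs ?c k * 0 ^ k) = 1 / Gamma (\<beta> + 1)"
    by (subst powser_zero) (simp add: diffs_def)
  ultimately show ?thesis
    by (simp add: mittag_leffler_def[abs_def])
qed

text \<open>This is the chain rule, kept relative to \<open>{a..}\<close> so that it also covers the
  endpoint \<open>t = a\<close>, where \<open>h\<close> need only be differentiable from the
  right.\<close>

lemma has_M_derivative_pos_if_has_field_derivative:
  assumes "\<beta> > 0" "t > 0" "t \<in> {a..}"
    and h: "(h has_field_derivative h') (at t within {a..})"
  shows "has_M_derivative_pos \<alpha> \<beta> {a..} h t (h' * (t powr (1 - \<alpha>) / Gamma (\<beta> + 1)))"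
proof -
  define \<phi> where "\<phi> = (\<lambda>\<epsilon>. t * mittag_leffler \<beta> (\<epsilon> * t powr (-\<alpha>)))"
  define d where "d = t powr (1 - \<alpha>) / Gamma (\<beta> + 1)"
  define A where "A = {\<epsilon>. \<phi> \<epsilon> \<in> {a..}}"
  have \<phi>0: "\<phi> 0 = t"
    by (simp add: \<phi>_def)
  have "Gamma (\<beta> + 1) > 0"
    using assms by (intro Gamma_real_pos) auto
  then have "d > 0"
    using assms by (simp add: d_def)
  have "t powr (1 - \<alpha>) = t * t powr (-\<alpha>)"
    using \<open>t > 0\<close> powr_add[of t 1 "-\<alpha>"] by simp
  moreover have "(mittag_leffler \<beta> has_field_derivative 1 / Gamma (\<beta> + 1)) (at (0 * t powr (-\<alpha>)))"
    using has_field_derivative_mittag_leffler_0[OF \<open>\<beta> > 0\<close>] by simp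
  ultimately have \<phi>: "(\<phi> has_field_derivative d) (at 0)"
    unfolding \<phi>_def d_def by (auto intro!: derivative_eq_intros DERIV_chain2)
  \<comment> \<open>As \<open>d > 0\<close>, small positive \<epsilon> move the argument to the
    right of \<open>t\<close>, hence stay in \<open>A\<close>; so the limit is not vacuous.\<close>
  obtain e where e: "e > 0" "\<And>\<epsilon>. 0 < \<epsilon> \<Longrightarrow> \<epsilon> < e \<Longrightarrow> t < \<phi> \<epsilon>"
    using DERIV_pos_inc_right[OF \<phi> \<open>d > 0\<close>] \<phi>0 by auto
  have "at 0 within {0<..<e} \<le> at 0 within A"
    using e(2) \<open>t \<in> {a..}\<close> by (intro at_le) (force simp: A_def)
  moreover have "at 0 within {0<..<e} \<noteq> bot"
    using e(1) by (simp add: at_within_eq_bot_iff)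
  ultimately have nontrivial: "at 0 within A \<noteq> bot"
    using bot.extremum_uniqueI by metis
  have "(h has_field_derivative h') (at (\<phi> 0) within \<phi> ` A)"
    unfolding \<phi>0 by (rule has_field_derivative_subset[OF h]) (auto simp: A_def)
  then have "(h \<circ> \<phi> has_field_derivative h' * d) (at 0 within A)"
    by (rule DERIV_image_chain[OF _ has_field_derivative_at_within[OF \<phi>]])
  then have "((\<lambda>\<epsilon>. (h (\<phi> \<epsilon>) - h t) / \<epsilon>) \<longlongrightarrow> h' * d) (at 0 within A)"
    by (simp add: has_field_derivative_iff \<phi>0)
  then show ?thesis
    using nontrivial assms unfolding has_M_derivative_pos_def Let_def A_def \<phi>_def d_def by blast
qed

text \<open>Integrability up to \<open>t + 1\<close> keeps \<open>t\<close> away from the right end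
  of the interval, so that derivatives within \<open>{a..t+1}\<close> and within
  \<open>{a..}\<close> agree at \<open>t\<close>.\<close>

lemma has_field_derivative_M_integral:
  assumes "t \<in> {a..}" "t > 0"
    and int: "M_integrable \<alpha> a f (t + 1)"
    and cont: "continuous (at t within {a..}) f"
  shows "(M_integral \<alpha> \<beta> a f has_field_derivative Gamma (\<beta> + 1) * (f t / t powr (1 - \<alpha>)))
    (at t within {a..})"
proof -
  let ?g = "\<lambda>x. f x / x powr (1 - \<alpha>)"
  have "continuous (at t within {a..}) ?g"
    using \<open>t > 0\<close> by (intro continuous_intros cont) auto
  \<comment> \<open>The empty set fills the exceptional set in the library form of the fundamental
    theorem.\<close>
  then have "continuous (at t within {a..t+1} - {}) ?g"
    by (rule continuous_within_subset) auto
  then have "((\<lambda>x. integral {a..x} ?g) has_vector_derivative ?g t) (at t within {a..t+1} - {})"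
    using assms by (intro integral_has_vector_derivative_continuous_at)
      (auto simp: M_integrable_def)
  then have "((\<lambda>x. integral {a..x} ?g) has_field_derivative ?g t) (at t within {a..t+1})"
    by (simp add: has_real_derivative_iff_has_vector_derivative)
  moreover have "at t within {a..t+1} = at t within {a..}"
    by (rule at_within_nhd[of _ "{..<t+1}"]) auto
  ultimately show ?thesis
    unfolding M_integral_def[abs_def] by (intro DERIV_cmult) simp
qed

lemma has_M_derivative_pos_M_integral:
  assumes "\<beta> > 0" "t \<in> {a..}" "t > 0" "M_integrable \<alpha> a f (t + 1)"
    and "continuous (at t within {a..}) f"
  shows "has_M_derivative_pos \<alpha> \<beta> {a..} (M_integral \<alpha> \<beta> a f) t (f t)"
proof -
  have "Gamma (\<beta> + 1) > 0"
    using assms by (intro Gamma_real_pos) auto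
  then have "Gamma (\<beta> + 1) * (f t / t powr (1 - \<alpha>)) * (t powr (1 - \<alpha>) / Gamma (\<beta> + 1)) = f t"
    using \<open>t > 0\<close> by (simp add: field_simps)
  then show ?thesis
    using has_M_derivative_pos_if_has_field_derivative[OF assms(1,3,2)
        has_field_derivative_M_integral[OF assms(2-5)], of \<alpha> \<beta>] by simp
qed

theorem theorem9:
  fixes a \<alpha> \<beta> t :: real and f :: "real \<Rightarrow> real" and D :: "real set"
  assumes "a \<ge> 0" and "0 < \<alpha>" and "\<alpha> < 1" and "\<beta> > 0"
    and "{a<..} \<subseteq> D" and "continuous_on D f"
    and "\<And>x. x \<ge> a \<Longrightarrow> M_integrable \<alpha> a f x"
    and "t \<ge> a" and "t \<in> D"
  shows "has_M_derivative \<alpha> \<beta> {a..} (M_integral \<alpha> \<beta> a f) t (f t)"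
proof -
  \<comment> \<open>\<open>D\<close> may or may not contain \<open>a\<close>: if
    \<open>s = a\<close>, then all of \<open>{a..}\<close> lies in \<open>D\<close>; if
    \<open>s > a\<close>, then \<open>s\<close> is interior to \<open>D\<close>.\<close>
  have cont: "continuous (at s within {a..}) f" if "s \<ge> a" "s \<in> D" for s
  proof (cases "s = a")
    case True
    then have "{a..} \<subseteq> D"
      using that assms(5) by (auto simp: subset_iff less_le)
    then show ?thesis
      using that assms(6) continuous_within_subset continuous_on_eq_continuous_within by blast
  next
    case False
    then have "s \<in> interior D"
      using that interior_maximal[OF assms(5)] by auto
    then show ?thesis
      using assms(6) continuous_on_interior continuous_at_imp_continuous_at_within by blast
  qed
  have pos: "has_M_derivative_pos \<alpha> \<beta> {a..} (M_integral \<alpha> \<beta> a f) s (f s)"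
    if "s \<ge> a" "s \<in> D" "s > 0" for s
    using that assms by (intro has_M_derivative_pos_M_integral cont) auto
  show ?thesis
  proof (cases "t = 0")
    case True
    then have "a = 0"
      using assms by simp
    have "(f \<longlongrightarrow> f 0) (at 0 within {0..})"
      using cont[of 0] assms True \<open>a = 0\<close> by (simp add: continuous_within)
    then have "(f \<longlongrightarrow> f 0) (at_right 0)"
      by (rule tendsto_within_subset) auto
    \<comment> \<open>The witnesses are \<open>g = f\<close> and the arbitrary radius
      \<open>r = 1\<close>.\<close>
    moreover have "\<forall>s\<in>{0<..<1}. has_M_derivative_pos \<alpha> \<beta> {a..} (M_integral \<alpha> \<beta> a f) s (f s)"
      using pos assms(5) \<open>a = 0\<close> by auto
    ultimately have "has_M_derivative_zero \<alpha> \<beta> {a..} (M_integral \<alpha> \<beta> a f) (f 0)"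
      unfolding has_M_derivative_zero_def using zero_less_one by blast
    then show ?thesis
      using True by (simp add: has_M_derivative_def)
  next
    case False
    then show ?thesis
      using pos[of t] assms by (simp add: has_M_derivative_def)
  qed
qed

end
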